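(* Let $n$ be a positive integer and let $r\in[1,\infty)$. Let $\mathbf 1_n$ denote the element of $\mathbb I^n$ all of whose coordinates equal $1$. Then $$\|V_r(S_k\chi_{\mathbf 1_n}:k\in\{0,\dots,n\})\|_2\geqslant 2n^{\frac1r}\,\|\chi_{\mathbf 1_n}\|_2.$$
   Context: $\mathbb I^n:=\{0,1\}^n$ is the hypercube with the Hamming metric $d(x,y):=|\{j:x(j)\neq y(j)\}|$. For $y\in\mathbb I^n$, $\chi_y:\mathbb I^n\to\mathbb C$ is $\chi_y(x):=(-1)^{x\cdot y}$ with $x\cdot y=\sum_{j=1}^nx(j)y(j)$. For $k\in\{0,\dots,n\}$ and $f:\mathbb I^n\to\mathbb C$, the spherical mean is $$S_kf(x):=\frac1{\binom nk}\sum_{y\in\mathbb I^n,\ d(x,y)=k}f(y),\qquad x\in\mathbb I^n.$$ The norm is $\|f\|_2:=\big(\sum_{x\in\mathbb I^n}|f(x)|^2\big)^{1/2}$. For $r\in[1,\infty)$, $Z\subseteq\{0,\dots,n\}$ and $x\in\mathbb I^n$, the $r$-variation seminorm is $$V_r(S_kf(x):k\in Z):=\sup_{k_0<k_1<\dots<k_J,\ k_j\in Z}\Big(\sum_{j=1}^J|S_{k_{j-1}}f(x)-S_{k_j}f(x)|^r\Big)^{1/r},$$ the supremum being over all finite nonempty strictly increasing sequences in $Z$. $V_r(S_kf:k\in Z)$ denotes the function $\mathbb I^n\ni x\mapsto V_r(S_kf(x):k\in Z)$. *)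

theory Defs
  imports Complex_Main "HOL-Library.FuncSet" "HOL-Analysis.L2_Norm"
begin

text \<open>
  Points of the hypercube are extensional functions on \<open>{1..n}\<close>; functions on the hypercube
  are total functions of which only the values on \<open>cube n\<close> matter.
\<close>

definition cube :: "nat \<Rightarrow> (nat \<Rightarrow> nat) set" where
  "cube n = {1..n} \<rightarrow>\<^sub>E {0, 1}"

definition hamming_dist :: "nat \<Rightarrow> (nat \<Rightarrow> nat) \<Rightarrow> (nat \<Rightarrow> nat) \<Rightarrow> nat" where
  "hamming_dist n x y = card {j \<in> {1..n}. x j \<noteq> y j}"

definition ones :: "nat \<Rightarrow> nat \<Rightarrow> nat" where
  "ones n = (\<lambda>j\<in>{1..n}. 1)"

definition chi :: "nat \<Rightarrow> (nat \<Rightarrow> nat) \<Rightarrow> (nat \<Rightarrow> nat) \<Rightarrow> complex" where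
  "chi n y x = (-1) ^ (\<Sum>j = 1..n. x j * y j)"

definition spherical_mean ::
  "nat \<Rightarrow> nat \<Rightarrow> ((nat \<Rightarrow> nat) \<Rightarrow> complex) \<Rightarrow> (nat \<Rightarrow> nat) \<Rightarrow> complex" where
  "spherical_mean n k f x =
     (1 / of_nat (n choose k)) * (\<Sum>y \<in> {y \<in> cube n. hamming_dist n x y = k}. f y)"

text \<open>
  The supremum is taken in the reals. It is the intended one for finite nonempty \<open>Z\<close>: the set
  below is then nonempty (case \<open>J = 0\<close>) and finite.
\<close>

definition variation :: "real \<Rightarrow> nat set \<Rightarrow> (nat \<Rightarrow> complex) \<Rightarrow> real" where
  "variation r Z a =
     Sup {(\<Sum>j = 1..J. cmod (a (k (j - 1)) - a (k j)) powr r) powr (1 / r) | (J :: nat) (k :: nat \<Rightarrow> nat).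
            strict_mono_on {0..J} k \<and> k ` {0..J} \<subseteq> Z}"

text \<open>Polymorphic, so that it applies to complex functions and to the real variation function.\<close>

definition l2_norm :: "nat \<Rightarrow> ((nat \<Rightarrow> nat) \<Rightarrow> 'a :: real_normed_vector) \<Rightarrow> real" where
  "l2_norm n f = L2_set (\<lambda>x. norm (f x)) (cube n)"

end

theory Submission
  imports Defs
begin

text \<open>
  Flipping \<open>k\<close> coordinates of \<open>x\<close> multiplies the full parity character by \<open>(-1)^k\<close>, so the character
  is an eigenfunction of every spherical mean with eigenvalue \<open>(-1)^k\<close>. Along the sequence
  \<open>0, 1, \<dots>, n\<close> each of the \<open>n\<close> increments of the means then has modulus 2.
\<close>

lemma cubeD: "x \<in> cube n \<Longrightarrow> j \<in> {1..n} \<Longrightarrow> x j = 0 \<or> x j = 1"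
  by (auto simp: cube_def PiE_iff)

text \<open>A point of the cube is determined by the set of coordinates where it differs from
  \<open>x\<close>, so the sphere corresponds to the \<open>k\<close>-subsets of
  \<open>{1..n}\<close>. The count cancels the normalisation in
  \<open>spherical_mean\<close>.\<close>

lemma card_hamming_sphere:
  assumes x: "x \<in> cube n"
  shows "card {y \<in> cube n. hamming_dist n x y = k} = n choose k"
proof -
  \<comment> \<open>Inverse of the difference-set map; on cube values the natural-number subtraction
    \<open>1 - x j\<close> swaps 0 and 1.\<close>
  let ?flip = "\<lambda>B. \<lambda>j\<in>{1..n}. if j \<in> B then 1 - x j else x j"
  have "bij_betw (\<lambda>y. {j \<in> {1..n}. x j \<noteq> y j})
      {y \<in> cube n. hamming_dist n x y = k} {B. B \<subseteq> {1..n} \<and> card B = k}"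
  proof (rule bij_betw_byWitness[where f' = ?flip])
    show "\<forall>y\<in>{y \<in> cube n. hamming_dist n x y = k}. ?flip {j \<in> {1..n}. x j \<noteq> y j} = y"
    proof
      fix y assume "y \<in> {y \<in> cube n. hamming_dist n x y = k}"
      then have y: "y \<in> cube n" by simp
      show "?flip {j \<in> {1..n}. x j \<noteq> y j} = y"
      proof
        fix j
        show "?flip {j \<in> {1..n}. x j \<noteq> y j} j = y j"
        proof (cases "j \<in> {1..n}")
          case True
          then show ?thesis using cubeD[OF x True] cubeD[OF y True] by auto
        next
          case False
          \<comment> \<open>Off \<open>{1..n}\<close> both functions take the default value of
            extensional functions, so they agree as total functions.\<close>
          with y have "y j = undefined" by (auto simp: cube_def PiE_iff extensional_def)
          with False show ?thesis by auto
        qed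
      qed
    qed
    have flip_diff: "{j \<in> {1..n}. x j \<noteq> ?flip B j} = B" if "B \<subseteq> {1..n}" for B
      using that cubeD[OF x] by (fastforce split: if_splits)
    then show "\<forall>B\<in>{B. B \<subseteq> {1..n} \<and> card B = k}. {j \<in> {1..n}. x j \<noteq> ?flip B j} = B"
      by blast
    show "(\<lambda>y. {j \<in> {1..n}. x j \<noteq> y j}) ` {y \<in> cube n. hamming_dist n x y = k}
        \<subseteq> {B. B \<subseteq> {1..n} \<and> card B = k}"
      by (auto simp: hamming_dist_def)
    have "?flip B \<in> cube n" for B
      unfolding cube_def using cubeD[OF x] by (intro restrict_PiE_iff[THEN iffD2]) auto
    then show "?flip ` {B. B \<subseteq> {1..n} \<and> card B = k} \<subseteq> {y \<in> cube n. hamming_dist n x y = k}"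
      using flip_diff unfolding hamming_dist_def by force
  qed
  then show ?thesis
    using n_subsets[of "{1..n}" k] by (simp add: bij_betw_same_card)
qed

lemma chi_ones: "chi n (ones n) x = (\<Prod>j = 1..n. (-1) ^ x j)"
  by (simp add: chi_def ones_def power_sum)

lemma norm_chi: "norm (chi n y x) = 1"
  by (simp add: chi_def norm_power)

lemma chi_ones_hamming_dist:
  assumes "x \<in> cube n" "y \<in> cube n"
  shows "chi n (ones n) y = (-1) ^ hamming_dist n x y * chi n (ones n) x"
proof -
  have "chi n (ones n) y
      = (\<Prod>j = 1..n. (if x j \<noteq> y j then -1 else 1) * (-1) ^ x j)"
    unfolding chi_ones
  proof (rule prod.cong)
    fix j assume "j \<in> {1..n}"
    then show "(-1 :: complex) ^ y j = (if x j \<noteq> y j then -1 else 1) * (-1) ^ x j"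
      using cubeD[OF assms(1)] cubeD[OF assms(2)] by force
  qed simp
  \<comment> \<open>The factors equal to 1 drop out, which leaves one -1 per differing
    coordinate.\<close>
  also have "\<dots> = (\<Prod>j\<in>{j \<in> {1..n}. x j \<noteq> y j}. -1) * chi n (ones n) x"
    by (simp only: prod.distrib chi_ones prod.inter_filter finite_atLeastAtMost)
  finally show ?thesis by (simp add: hamming_dist_def)
qed

lemma spherical_mean_chi_ones:
  assumes "x \<in> cube n" "k \<le> n"
  shows "spherical_mean n k (chi n (ones n)) x = (-1) ^ k * chi n (ones n) x"
proof -
  have "(\<Sum>y \<in> {y \<in> cube n. hamming_dist n x y = k}. chi n (ones n) y)
      = (\<Sum>y \<in> {y \<in> cube n. hamming_dist n x y = k}. (-1) ^ k * chi n (ones n) x)"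
    using chi_ones_hamming_dist[OF assms(1)] by (intro sum.cong) auto
  \<comment> \<open>As \<open>k \<le> n\<close>, the size \<open>n choose k\<close> of the sphere is
    nonzero and cancels.\<close>
  with assms show ?thesis
    by (simp add: spherical_mean_def card_hamming_sphere)
qed

text \<open>A real \<open>Sup\<close> dominates the members of its set only once the set is known to
  be bounded. A crude bound suffices: finiteness of \<open>Z\<close> limits both the number of
  increments and the size of each.\<close>

lemma bdd_above_variation:
  fixes a :: "nat \<Rightarrow> complex"
  assumes "finite Z" "r > 0"
  shows "bdd_above {(\<Sum>j = 1..J. cmod (a (k (j - 1)) - a (k j)) powr r) powr (1 / r)
           | (J :: nat) (k :: nat \<Rightarrow> nat). strict_mono_on {0..J} k \<and> k ` {0..J} \<subseteq> Z}"
proof (rule bdd_aboveI, clarify)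
  fix J :: nat and k :: "nat \<Rightarrow> nat"
  assume k: "strict_mono_on {0..J} k" "k ` {0..J} \<subseteq> Z"
  define B where "B = 2 * (\<Sum>i\<in>Z. cmod (a i))"
  \<comment> \<open>A strictly increasing \<open>k\<close> is injective, so its \<open>J + 1\<close>
    values fit into \<open>Z\<close>; this makes the bound uniform in \<open>J\<close>.\<close>
  have "card {0..J} \<le> card Z"
    using k assms by (intro card_inj_on_le[of k]) (auto intro: strict_mono_on_imp_inj_on)
  then have J: "J \<le> card Z" by simp
  have le: "cmod (a i) \<le> (\<Sum>i\<in>Z. cmod (a i))" if "i \<in> Z" for i
    using that assms by (intro member_le_sum) auto
  have "cmod (a (k (j - 1)) - a (k j)) \<le> B" if "j \<in> {1..J}" for j
  proof -
    have "k (j - 1) \<in> Z" "k j \<in> Z" using that k(2) by (auto simp: image_subset_iff)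
    from le[OF this(1)] le[OF this(2)] show ?thesis
      using norm_triangle_ineq4[of "a (k (j - 1))" "a (k j)"] by (simp add: B_def)
  qed
  then have "(\<Sum>j = 1..J. cmod (a (k (j - 1)) - a (k j)) powr r) \<le> (\<Sum>j = 1..J. B powr r)"
    using assms by (intro sum_mono powr_mono2) auto
  also have "\<dots> \<le> card Z * B powr r"
    using J by (simp add: mult_right_mono)
  finally show "(\<Sum>j = 1..J. cmod (a (k (j - 1)) - a (k j)) powr r) powr (1 / r)
      \<le> (card Z * B powr r) powr (1 / r)"
    using assms by (intro powr_mono2) (auto intro: sum_nonneg)
qed

lemma variation_ge:
  fixes J :: nat
  assumes "finite Z" "r > 0" "strict_mono_on {0..J} k" "k ` {0..J} \<subseteq> Z"
  shows "(\<Sum>j = 1..J. cmod (a (k (j - 1)) - a (k j)) powr r) powr (1 / r) \<le> variation r Z a"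
  unfolding variation_def
proof (rule cSup_upper)
  show "(\<Sum>j = 1..J. cmod (a (k (j - 1)) - a (k j)) powr r) powr (1 / r)
      \<in> {(\<Sum>j = 1..J. cmod (a (k (j - 1)) - a (k j)) powr r) powr (1 / r)
           | (J :: nat) (k :: nat \<Rightarrow> nat). strict_mono_on {0..J} k \<and> k ` {0..J} \<subseteq> Z}"
    unfolding mem_Collect_eq by (rule exI[of _ J], rule exI[of _ k]) (simp add: assms(3,4))
qed (rule bdd_above_variation[OF assms(1,2)])

lemma variation_spherical_mean_chi_ones_ge:
  assumes "x \<in> cube n" "r > 0"
  shows "2 * real n powr (1 / r)
    \<le> variation r {0..n} (\<lambda>k. spherical_mean n k (chi n (ones n)) x)"
proof -
  let ?a = "\<lambda>k. spherical_mean n k (chi n (ones n)) x"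
  have "cmod (?a (j - 1) - ?a j) = 2" if j: "j \<in> {1..n}" for j
  proof -
    obtain i where i: "j = Suc i" using j by (cases j) auto
    \<comment> \<open>Consecutive eigenvalues have opposite signs: (-1)^i - (-1)^(i+1) = 2
      (-1)^i.\<close>
    have "?a (j - 1) - ?a j = 2 * (-1) ^ i * chi n (ones n) x"
      using j i assms by (simp add: spherical_mean_chi_ones)
    then show ?thesis by (simp add: norm_mult norm_power norm_chi)
  qed
  then have "(\<Sum>j = 1..n. cmod (?a (j - 1) - ?a j) powr r) powr (1 / r)
      = (real n * 2 powr r) powr (1 / r)"
    by simp
  also have "\<dots> = 2 * real n powr (1 / r)"
    using assms by (simp add: powr_mult powr_powr)
  finally show ?thesis
    using variation_ge[of "{0..n}" r n "\<lambda>k. k" ?a] assms(2) by (simp add: strict_mono_on_def)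
qed

theorem mainTheorem5:
  fixes n :: nat and r :: real
  assumes "n \<ge> 1" and "r \<ge> 1"
  shows "l2_norm n (\<lambda>x. variation r {0..n} (\<lambda>k. spherical_mean n k (chi n (ones n)) x))
           \<ge> 2 * real n powr (1 / r) * l2_norm n (chi n (ones n))"
proof -
  have "2 * real n powr (1 / r) * l2_norm n (chi n (ones n))
      = L2_set (\<lambda>x. 2 * real n powr (1 / r) * norm (chi n (ones n) x)) (cube n)"
    unfolding l2_norm_def by (intro L2_set_right_distrib) simp
  also have "\<dots> \<le> l2_norm n (\<lambda>x. variation r {0..n} (\<lambda>k. spherical_mean n k (chi n (ones n)) x))"
    unfolding l2_norm_def
  proof (rule L2_set_mono)
    fix x assume "x \<in> cube n"
    \<comment> \<open>The character has modulus 1, so its norm can be inserted into the pointwise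
      bound; on the right, \<open>norm\<close> is an absolute value and can only increase the
      variation.\<close>
    from variation_spherical_mean_chi_ones_ge[OF this, of r] assms(2)
    show "2 * real n powr (1 / r) * norm (chi n (ones n) x)
        \<le> norm (variation r {0..n} (\<lambda>k. spherical_mean n k (chi n (ones n)) x))"
      by (simp add: norm_chi)
  qed simp
  finally show ?thesis .
qed

end
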